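(* Let $(R,\preceq)$ be a quasi-ordered ring with $E_0=\{0\}$ (so that $R$ is an integral domain), and let $K:=\mathrm{Quot}(R)$ be its field of fractions. For $a,b,x,y\in R$ with $b,y\neq 0$ define $$\frac{a}{b}\trianglelefteq\frac{x}{y}\;:\Leftrightarrow\; aby^2\preceq xyb^2 .$$ Then $\trianglelefteq$ is a (well-defined) relation on $K$ that extends $\preceq$ from $R$ to $K$, and $(K,\trianglelefteq)$ is a quasi-ordered field.
   Context: For a reflexive and transitive binary relation $\preceq$, write $a\sim b$ for ($a\preceq b$ and $b\preceq a$), and $a\prec b$ for ($a\preceq b$ and not $b\preceq a$). Quasi-ordered ring: a pair $(R,\preceq)$ where $R$ is a commutative ring with $1$ and $\preceq$ is a binary, reflexive, transitive and total relation on $R$ such that for all $x,y,z\in R$: (QR1) $0\prec 1$; (QR2) $xy\preceq 0\Rightarrow x\preceq 0$ or $y\preceq 0$; (QR3) $x\preceq y$ and $0\preceq z\Rightarrow xz\preceq yz$; (QR4) $x\preceq y$ and $z\nsim y\Rightarrow x+z\preceq y+z$; (QR5) if $0\prec z$, then $xz\preceq yz\Rightarrow x\preceq y$. Its support is $E_0=\{x\in R: x\sim 0\}$; it is a prime ideal of $R$. Quasi-ordered field: a pair $(K,\preceq)$ where $K$ is a field and $\preceq$ is a binary, reflexive, transitive and total relation on $K$ such that for all $x,y,z\in K$: (Q1) $x\sim 0\Rightarrow x=0$; (Q2) $x\preceq y$ and $0\preceq z\Rightarrow xz\preceq yz$; (Q3) $x\preceq y$ and $z\nsim y\Rightarrow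 x+z\preceq y+z$. "Extends" means: for all $x,y\in R$, $\frac{x}{1}\trianglelefteq\frac{y}{1}\Leftrightarrow x\preceq y$. *)

theory Defs
  imports "HOL-Algebra.Ring"
begin

section \<open>Quasi-ordered rings and fields\<close>

definition qo_equiv :: "('a \<Rightarrow> 'a \<Rightarrow> bool) \<Rightarrow> 'a \<Rightarrow> 'a \<Rightarrow> bool" where
  "qo_equiv leq a b \<longleftrightarrow> leq a b \<and> leq b a"

definition qo_less :: "('a \<Rightarrow> 'a \<Rightarrow> bool) \<Rightarrow> 'a \<Rightarrow> 'a \<Rightarrow> bool" where
  "qo_less leq a b \<longleftrightarrow> leq a b \<and> \<not> leq b a"

text \<open>Relations are only constrained on the carrier; their values elsewhere are irrelevant.\<close>

locale quasi_ordered_ring = cring R for R (structure) +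
  fixes leq :: "'a \<Rightarrow> 'a \<Rightarrow> bool" (infix \<open>\<preceq>\<close> 50)
  assumes qo_refl: "x \<in> carrier R \<Longrightarrow> x \<preceq> x"
    and qo_trans: "\<lbrakk>x \<in> carrier R; y \<in> carrier R; z \<in> carrier R; x \<preceq> y; y \<preceq> z\<rbrakk> \<Longrightarrow> x \<preceq> z"
    and qo_total: "\<lbrakk>x \<in> carrier R; y \<in> carrier R\<rbrakk> \<Longrightarrow> x \<preceq> y \<or> y \<preceq> x"
    and QR1: "qo_less (\<preceq>) \<zero> \<one>"
    and QR2: "\<lbrakk>x \<in> carrier R; y \<in> carrier R; x \<otimes> y \<preceq> \<zero>\<rbrakk> \<Longrightarrow> x \<preceq> \<zero> \<or> y \<preceq> \<zero>"
    and QR3: "\<lbrakk>x \<in> carrier R; y \<in> carrier R; z \<in> carrier R; x \<preceq> y; \<zero> \<preceq> z\<rbrakk>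
                \<Longrightarrow> x \<otimes> z \<preceq> y \<otimes> z"
    and QR4: "\<lbrakk>x \<in> carrier R; y \<in> carrier R; z \<in> carrier R; x \<preceq> y; \<not> qo_equiv (\<preceq>) z y\<rbrakk>
                \<Longrightarrow> x \<oplus> z \<preceq> y \<oplus> z"
    and QR5: "\<lbrakk>x \<in> carrier R; y \<in> carrier R; z \<in> carrier R; qo_less (\<preceq>) \<zero> z;
                x \<otimes> z \<preceq> y \<otimes> z\<rbrakk> \<Longrightarrow> x \<preceq> y"

definition qo_support :: "('a, 'm) ring_scheme \<Rightarrow> ('a \<Rightarrow> 'a \<Rightarrow> bool) \<Rightarrow> 'a set" where
  "qo_support R leq = {x \<in> carrier R. qo_equiv leq x \<zero>\<^bsub>R\<^esub>}"

locale quasi_ordered_field = field K for K (structure) +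
  fixes leq :: "'a \<Rightarrow> 'a \<Rightarrow> bool" (infix \<open>\<preceq>\<close> 50)
  assumes qo_refl: "x \<in> carrier K \<Longrightarrow> x \<preceq> x"
    and qo_trans: "\<lbrakk>x \<in> carrier K; y \<in> carrier K; z \<in> carrier K; x \<preceq> y; y \<preceq> z\<rbrakk> \<Longrightarrow> x \<preceq> z"
    and qo_total: "\<lbrakk>x \<in> carrier K; y \<in> carrier K\<rbrakk> \<Longrightarrow> x \<preceq> y \<or> y \<preceq> x"
    and Q1: "\<lbrakk>x \<in> carrier K; qo_equiv (\<preceq>) x \<zero>\<rbrakk> \<Longrightarrow> x = \<zero>"
    and Q2: "\<lbrakk>x \<in> carrier K; y \<in> carrier K; z \<in> carrier K; x \<preceq> y; \<zero> \<preceq> z\<rbrakk>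
                \<Longrightarrow> x \<otimes> z \<preceq> y \<otimes> z"
    and Q3: "\<lbrakk>x \<in> carrier K; y \<in> carrier K; z \<in> carrier K; x \<preceq> y; \<not> qo_equiv (\<preceq>) z y\<rbrakk>
                \<Longrightarrow> x \<oplus> z \<preceq> y \<oplus> z"


section \<open>The field of fractions\<close>

text \<open>
  The library type of fractions \<open>fract\<close> requires the type class \<open>idom\<close>. Here \<open>R\<close> is only
  assumed to be a commutative ring, and being a domain is a consequence of the order axioms,
  so the field of fractions is built for ring records. The constructions below are
  meaningful when \<open>R\<close> is a domain.
\<close>

definition denoms :: "('a, 'm) ring_scheme \<Rightarrow> 'a set" where
  "denoms R = carrier R - {\<zero>\<^bsub>R\<^esub>}"

definition frac_rel :: "('a, 'm) ring_scheme \<Rightarrow> (('a \<times> 'a) \<times> ('a \<times> 'a)) set" where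
  "frac_rel R = {((a, b), (c, d)).
     a \<in> carrier R \<and> b \<in> denoms R \<and> c \<in> carrier R \<and> d \<in> denoms R \<and>
     a \<otimes>\<^bsub>R\<^esub> d = c \<otimes>\<^bsub>R\<^esub> b}"

definition fraction :: "('a, 'm) ring_scheme \<Rightarrow> 'a \<Rightarrow> 'a \<Rightarrow> ('a \<times> 'a) set" where
  "fraction R a b = frac_rel R `` {(a, b)}"

text \<open>
  As usual for quotients by an equivalence relation, the operations take the union over all
  representatives; when the result does not depend on them this is the common class.
\<close>

definition Quot_field :: "('a, 'm) ring_scheme \<Rightarrow> ('a \<times> 'a) set ring" where
  "Quot_field R = \<lparr>
     carrier = (carrier R \<times> denoms R) // frac_rel R,
     mult = (\<lambda>X Y. \<Union>(a, b)\<in>X. \<Union>(c, d)\<in>Y. fraction R (a \<otimes>\<^bsub>R\<^esub> c) (b \<otimes>\<^bsub>R\<^esub> d)),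
     one = fraction R \<one>\<^bsub>R\<^esub> \<one>\<^bsub>R\<^esub>,
     zero = fraction R \<zero>\<^bsub>R\<^esub> \<one>\<^bsub>R\<^esub>,
     add = (\<lambda>X Y. \<Union>(a, b)\<in>X. \<Union>(c, d)\<in>Y.
              fraction R (a \<otimes>\<^bsub>R\<^esub> d \<oplus>\<^bsub>R\<^esub> c \<otimes>\<^bsub>R\<^esub> b) (b \<otimes>\<^bsub>R\<^esub> d)) \<rparr>"


section \<open>The induced relation on fractions\<close>

definition frac_le_rep ::
  "('a, 'm) ring_scheme \<Rightarrow> ('a \<Rightarrow> 'a \<Rightarrow> bool) \<Rightarrow> 'a \<Rightarrow> 'a \<Rightarrow> 'a \<Rightarrow> 'a \<Rightarrow> bool" where
  "frac_le_rep R leq a b x y \<longleftrightarrow>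
     leq (a \<otimes>\<^bsub>R\<^esub> b \<otimes>\<^bsub>R\<^esub> y [^]\<^bsub>R\<^esub> (2::nat)) (x \<otimes>\<^bsub>R\<^esub> y \<otimes>\<^bsub>R\<^esub> b [^]\<^bsub>R\<^esub> (2::nat))"

text \<open>
  On classes the relation is asked for some pair of representatives. That the choice is
  irrelevant, i.e. that the relation is well defined, has to be proved.
\<close>

definition frac_le ::
  "('a, 'm) ring_scheme \<Rightarrow> ('a \<Rightarrow> 'a \<Rightarrow> bool) \<Rightarrow> ('a \<times> 'a) set \<Rightarrow> ('a \<times> 'a) set \<Rightarrow> bool" where
  "frac_le R leq X Y \<longleftrightarrow> (\<exists>(a, b)\<in>X. \<exists>(x, y)\<in>Y. frac_le_rep R leq a b x y)"

end

theory Submission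
  imports Defs
begin

text \<open>
  Nonzero squares are strictly positive, so every element of the quotient field is a fraction
  with positive denominator, and finitely many elements have a common such denominator. Fractions
  over the same positive denominator are compared, and added, through their numerators, so every
  axiom for the quotient field reduces to the corresponding axiom for the ring.
\<close>

section \<open>The field of fractions of a domain\<close>

lemma (in domain) denoms_mult:
  assumes "b \<in> denoms R" "d \<in> denoms R"
  shows "b \<otimes> d \<in> denoms R"
  using assms integral_iff by (auto simp: denoms_def)

lemma (in domain) one_in_denoms: "\<one> \<in> denoms R"
  by (simp add: denoms_def)

lemma (in cring) denoms_closed: "b \<in> denoms R \<Longrightarrow> b \<in> carrier R"
  by (simp add: denoms_def)

text \<open>Transitivity is the only clause with content: after multiplication by the middle
  denominator \<open>d\<close> both given equations can be applied, and \<open>d\<close> is then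
  cancelled because it is nonzero in a domain.\<close>

lemma (in domain) equiv_frac_rel: "equiv (carrier R \<times> denoms R) (frac_rel R)"
proof (rule equivI)
  show "frac_rel R \<subseteq> (carrier R \<times> denoms R) \<times> (carrier R \<times> denoms R)"
    by (auto simp: frac_rel_def)
  show "refl_on (carrier R \<times> denoms R) (frac_rel R)"
    by (auto simp: refl_on_def frac_rel_def)
  show "sym (frac_rel R)"
    by (auto simp: sym_def frac_rel_def)
  show "trans (frac_rel R)"
  proof (rule transI)
    fix p q r assume pq: "(p, q) \<in> frac_rel R" and qr: "(q, r) \<in> frac_rel R"
    obtain a b c d e f where pqr: "p = (a, b)" "q = (c, d)" "r = (e, f)"
      by (metis surj_pair)
    have cl: "a \<in> carrier R" "b \<in> denoms R" "c \<in> carrier R" "d \<in> denoms R"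
        "e \<in> carrier R" "f \<in> denoms R"
      and eqs: "a \<otimes> d = c \<otimes> b" "c \<otimes> f = e \<otimes> d"
      using pq qr pqr by (auto simp: frac_rel_def)
    note cl' = cl denoms_closed[OF cl(2)] denoms_closed[OF cl(4)] denoms_closed[OF cl(6)]
    have "(a \<otimes> f) \<otimes> d = (a \<otimes> d) \<otimes> f" using cl' by (simp add: m_ac)
    also have "\<dots> = (c \<otimes> f) \<otimes> b" using cl' by (simp add: eqs(1) m_ac)
    also have "\<dots> = (e \<otimes> b) \<otimes> d" using cl' by (simp add: eqs(2) m_ac)
    finally have "a \<otimes> f = e \<otimes> b"
      using cl' m_rcancel[of d "a \<otimes> f" "e \<otimes> b"] by (auto simp: denoms_def)
    then show "(p, r) \<in> frac_rel R" using cl pqr by (simp add: frac_rel_def)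
  qed
qed

lemma (in domain) fraction_eq_iff:
  assumes "a \<in> carrier R" "b \<in> denoms R" "c \<in> carrier R" "d \<in> denoms R"
  shows "fraction R a b = fraction R c d \<longleftrightarrow> a \<otimes> d = c \<otimes> b"
proof -
  have "fraction R a b = fraction R c d \<longleftrightarrow> ((a, b), (c, d)) \<in> frac_rel R"
    unfolding fraction_def using assms by (intro eq_equiv_class_iff[OF equiv_frac_rel]) auto
  then show ?thesis using assms by (simp add: frac_rel_def)
qed

lemma (in domain) fraction_self_mem:
  assumes "a \<in> carrier R" "b \<in> denoms R"
  shows "(a, b) \<in> fraction R a b"
  using assms by (simp add: fraction_def frac_rel_def)

lemma (in domain) fraction_memD:
  assumes "(c, d) \<in> fraction R a b"
  shows "c \<in> carrier R" "d \<in> denoms R" "a \<otimes> d = c \<otimes> b"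
  using assms by (auto simp: fraction_def frac_rel_def)

lemma (in domain) fraction_cancel:
  assumes "a \<in> carrier R" "b \<in> denoms R" "c \<in> denoms R"
  shows "fraction R (a \<otimes> c) (b \<otimes> c) = fraction R a b"
  using assms denoms_closed[OF assms(2)] denoms_closed[OF assms(3)]
  by (simp add: fraction_eq_iff denoms_mult m_ac)

lemma (in domain) fraction_in_Quot:
  assumes "a \<in> carrier R" "b \<in> denoms R"
  shows "fraction R a b \<in> carrier (Quot_field R)"
  using assms by (auto simp: Quot_field_def fraction_def intro: quotientI)

lemma Quot_field_cases:
  assumes "X \<in> carrier (Quot_field R)"
  obtains a b where "a \<in> carrier R" "b \<in> denoms R" "X = fraction R a b"
  using assms by (auto simp: Quot_field_def fraction_def elim!: quotientE)

text \<open>Three elements suffice because no axiom involves more. The denominator is made a square,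
  not just common, so that it will be strictly positive for the order and comparisons can be read
  off the numerators.\<close>

lemma (in domain) Quot_common_denom:
  assumes "X \<in> carrier (Quot_field R)" "Y \<in> carrier (Quot_field R)" "Z \<in> carrier (Quot_field R)"
  obtains x y z d where "x \<in> carrier R" "y \<in> carrier R" "z \<in> carrier R" "d \<in> denoms R"
    "X = fraction R x (d \<otimes> d)" "Y = fraction R y (d \<otimes> d)" "Z = fraction R z (d \<otimes> d)"
proof -
  \<comment> \<open>Expanding \<open>a/b\<close> by \<open>c \<otimes> (b \<otimes> c)\<close> turns
    the denominator into the square of \<open>b \<otimes> c\<close>.\<close>
  have rescale: "fraction R a b = fraction R (a \<otimes> (c \<otimes> (b \<otimes> c))) ((b \<otimes> c) \<otimes> (b \<otimes> c))"
    if "a \<in> carrier R" "b \<in> denoms R" "c \<in> denoms R" for a b c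
    using that fraction_cancel[of a b "c \<otimes> (b \<otimes> c)"]
    by (simp add: denoms_mult denoms_closed m_assoc)
  obtain a b where ab: "a \<in> carrier R" "b \<in> denoms R" "X = fraction R a b"
    using assms(1) by (rule Quot_field_cases)
  obtain p q where pq: "p \<in> carrier R" "q \<in> denoms R" "Y = fraction R p q"
    using assms(2) by (rule Quot_field_cases)
  obtain u v where uv: "u \<in> carrier R" "v \<in> denoms R" "Z = fraction R u v"
    using assms(3) by (rule Quot_field_cases)
  \<comment> \<open>The product of all three denominators; the regroupings below bring each single
    denominator to the front, with the product of the other two as the \<open>c\<close> of
    \<open>rescale\<close>.\<close>
  let ?d = "b \<otimes> (q \<otimes> v)"
  have d: "?d = q \<otimes> (b \<otimes> v)" "?d = v \<otimes> (b \<otimes> q)"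
    using ab pq uv by (simp_all add: denoms_closed m_ac)
  show ?thesis
  proof (rule that)
    show "?d \<in> denoms R" using ab pq uv by (simp add: denoms_mult)
    show "X = fraction R (a \<otimes> ((q \<otimes> v) \<otimes> ?d)) (?d \<otimes> ?d)"
      using rescale[of a b "q \<otimes> v"] ab pq uv by (simp add: denoms_mult)
    show "Y = fraction R (p \<otimes> ((b \<otimes> v) \<otimes> ?d)) (?d \<otimes> ?d)"
      unfolding d(1) using rescale[of p q "b \<otimes> v"] ab pq uv by (simp add: denoms_mult)
    show "Z = fraction R (u \<otimes> ((b \<otimes> q) \<otimes> ?d)) (?d \<otimes> ?d)"
      unfolding d(2) using rescale[of u v "b \<otimes> q"] ab pq uv by (simp add: denoms_mult)
  qed (use ab pq uv in \<open>simp_all add: denoms_closed\<close>)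
qed

section \<open>Arithmetic of classes and the field axioms\<close>

lemma Quot_one: "\<one>\<^bsub>Quot_field R\<^esub> = fraction R \<one>\<^bsub>R\<^esub> \<one>\<^bsub>R\<^esub>"
  by (simp add: Quot_field_def)

lemma (in domain) Quot_zero:
  assumes "d \<in> denoms R"
  shows "\<zero>\<^bsub>Quot_field R\<^esub> = fraction R \<zero> d"
  using assms by (simp add: Quot_field_def fraction_eq_iff one_in_denoms denoms_closed)

text \<open>This collapses the unions over representatives in \<open>Quot_field\<close> once
  independence of the representatives is known. The members \<open>p\<close> and \<open>q\<close>
  exclude an empty union, which would give the empty set instead of \<open>S\<close>.\<close>

lemma UN_case_prod_const:
  assumes "p \<in> A" "q \<in> B" and "\<And>a b c d. (a, b) \<in> A \<Longrightarrow> (c, d) \<in> B \<Longrightarrow> f a b c d = S"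
  shows "(\<Union>(a, b)\<in>A. \<Union>(c, d)\<in>B. f a b c d) = S"
proof (rule SUP_eq_const)
  show "A \<noteq> {}" using assms(1) by blast
  fix x assume "x \<in> A"
  then have "(\<Union>(c, d)\<in>B. f (fst x) (snd x) c d) = S"
    using assms(2,3) by (intro SUP_eq_const) (auto split: prod.splits)
  then show "(case x of (a, b) \<Rightarrow> \<Union>(c, d)\<in>B. f a b c d) = S"
    by (simp add: case_prod_beta)
qed

text \<open>The work is independence of representatives: the cross product is regrouped into
  \<open>a' \<otimes> b\<close> and \<open>c' \<otimes> d\<close>, the two factors that membership
  in the classes allows to be exchanged.\<close>

lemma (in domain) Quot_mult:
  assumes "a \<in> carrier R" "b \<in> denoms R" "c \<in> carrier R" "d \<in> denoms R"
  shows "fraction R a b \<otimes>\<^bsub>Quot_field R\<^esub> fraction R c d = fraction R (a \<otimes> c) (b \<otimes> d)"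
proof -
  have indep: "fraction R (a' \<otimes> c') (b' \<otimes> d') = fraction R (a \<otimes> c) (b \<otimes> d)"
    if "(a', b') \<in> fraction R a b" "(c', d') \<in> fraction R c d" for a' b' c' d'
  proof -
    note A = fraction_memD[OF that(1)] and C = fraction_memD[OF that(2)]
    note cl = assms A(1,2) C(1,2) assms(2,4)[THEN denoms_closed] A(2)[THEN denoms_closed]
      C(2)[THEN denoms_closed]
    have "(a' \<otimes> c') \<otimes> (b \<otimes> d) = (a' \<otimes> b) \<otimes> (c' \<otimes> d)" using cl by (simp add: m_ac)
    also have "\<dots> = (a \<otimes> b') \<otimes> (c \<otimes> d')" by (simp only: A(3) C(3))
    also have "\<dots> = (a \<otimes> c) \<otimes> (b' \<otimes> d')" using cl by (simp add: m_ac)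
    finally show ?thesis using cl by (simp add: fraction_eq_iff denoms_mult)
  qed
  have "(\<Union>(a', b')\<in>fraction R a b. \<Union>(c', d')\<in>fraction R c d. fraction R (a' \<otimes> c') (b' \<otimes> d'))
      = fraction R (a \<otimes> c) (b \<otimes> d)"
    using fraction_self_mem[OF assms(1,2)] fraction_self_mem[OF assms(3,4)] indep
    by (rule UN_case_prod_const)
  then show ?thesis by (simp add: Quot_field_def)
qed

text \<open>As for products, except that after distributing each summand contains just one of the
  exchangeable factors \<open>a' \<otimes> b\<close> and \<open>c' \<otimes> d\<close>.\<close>

lemma (in domain) Quot_add:
  assumes "a \<in> carrier R" "b \<in> denoms R" "c \<in> carrier R" "d \<in> denoms R"
  shows "fraction R a b \<oplus>\<^bsub>Quot_field R\<^esub> fraction R c d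
    = fraction R (a \<otimes> d \<oplus> c \<otimes> b) (b \<otimes> d)"
proof -
  have indep: "fraction R (a' \<otimes> d' \<oplus> c' \<otimes> b') (b' \<otimes> d')
      = fraction R (a \<otimes> d \<oplus> c \<otimes> b) (b \<otimes> d)"
    if "(a', b') \<in> fraction R a b" "(c', d') \<in> fraction R c d" for a' b' c' d'
  proof -
    note A = fraction_memD[OF that(1)] and C = fraction_memD[OF that(2)]
    note cl = assms A(1,2) C(1,2) assms(2,4)[THEN denoms_closed] A(2)[THEN denoms_closed]
      C(2)[THEN denoms_closed]
    have "(a' \<otimes> d' \<oplus> c' \<otimes> b') \<otimes> (b \<otimes> d)
        = (a' \<otimes> b) \<otimes> (d \<otimes> d') \<oplus> (c' \<otimes> d) \<otimes> (b \<otimes> b')"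
      using cl by (simp add: l_distr r_distr m_ac)
    also have "\<dots> = (a \<otimes> b') \<otimes> (d \<otimes> d') \<oplus> (c \<otimes> d') \<otimes> (b \<otimes> b')"
      by (simp only: A(3) C(3))
    also have "\<dots> = (a \<otimes> d \<oplus> c \<otimes> b) \<otimes> (b' \<otimes> d')"
      using cl by (simp add: l_distr r_distr m_ac)
    finally show ?thesis using cl by (simp add: fraction_eq_iff denoms_mult)
  qed
  have "(\<Union>(a', b')\<in>fraction R a b. \<Union>(c', d')\<in>fraction R c d.
          fraction R (a' \<otimes> d' \<oplus> c' \<otimes> b') (b' \<otimes> d'))
      = fraction R (a \<otimes> d \<oplus> c \<otimes> b) (b \<otimes> d)"
    using fraction_self_mem[OF assms(1,2)] fraction_self_mem[OF assms(3,4)] indep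
    by (rule UN_case_prod_const)
  then show ?thesis by (simp add: Quot_field_def)
qed

text \<open>The general sum has denominator \<open>d \<otimes> d\<close>, and one factor
  \<open>d\<close> cancels. Over a common denominator, additive laws thus become those of R on
  numerators.\<close>

lemma (in domain) Quot_add_same_denom:
  assumes "a \<in> carrier R" "c \<in> carrier R" "d \<in> denoms R"
  shows "fraction R a d \<oplus>\<^bsub>Quot_field R\<^esub> fraction R c d = fraction R (a \<oplus> c) d"
  using assms fraction_cancel[of "a \<oplus> c" d d]
  by (simp add: Quot_add l_distr denoms_closed)

lemma (in domain) field_Quot_field: "field (Quot_field R)"
proof -
  let ?Q = "Quot_field R"
  have abelian: "abelian_group ?Q"
  proof (rule abelian_groupI)
    show "\<zero>\<^bsub>?Q\<^esub> \<in> carrier ?Q"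
      by (simp add: Quot_zero[OF one_in_denoms] fraction_in_Quot one_in_denoms)
  next
    fix X Y assume "X \<in> carrier ?Q" "Y \<in> carrier ?Q"
    then obtain x y z d where xy: "x \<in> carrier R" "y \<in> carrier R" "d \<in> denoms R"
      and XY: "X = fraction R x (d \<otimes> d)" "Y = fraction R y (d \<otimes> d)"
      \<comment> \<open>With only two elements to treat, the second one also fills the third
        place.\<close>
      using Quot_common_denom[of X Y Y] by metis
    show "X \<oplus>\<^bsub>?Q\<^esub> Y \<in> carrier ?Q"
      using xy by (simp add: XY Quot_add_same_denom denoms_mult fraction_in_Quot)
    show "X \<oplus>\<^bsub>?Q\<^esub> Y = Y \<oplus>\<^bsub>?Q\<^esub> X"
      using xy by (simp add: XY Quot_add_same_denom denoms_mult a_comm)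
  next
    fix X Y Z assume "X \<in> carrier ?Q" "Y \<in> carrier ?Q" "Z \<in> carrier ?Q"
    then obtain x y z d where xyz: "x \<in> carrier R" "y \<in> carrier R" "z \<in> carrier R" "d \<in> denoms R"
      and XYZ: "X = fraction R x (d \<otimes> d)" "Y = fraction R y (d \<otimes> d)" "Z = fraction R z (d \<otimes> d)"
      by (rule Quot_common_denom)
    show "X \<oplus>\<^bsub>?Q\<^esub> Y \<oplus>\<^bsub>?Q\<^esub> Z = X \<oplus>\<^bsub>?Q\<^esub> (Y \<oplus>\<^bsub>?Q\<^esub> Z)"
      using xyz by (simp add: XYZ Quot_add_same_denom denoms_mult a_assoc)
  next
    fix X assume "X \<in> carrier ?Q"
    then obtain a b where ab: "a \<in> carrier R" "b \<in> denoms R" and X: "X = fraction R a b"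
      by (rule Quot_field_cases)
    show "\<zero>\<^bsub>?Q\<^esub> \<oplus>\<^bsub>?Q\<^esub> X = X"
      using ab by (simp add: X Quot_zero[OF ab(2)] Quot_add_same_denom)
    show "\<exists>Y\<in>carrier ?Q. Y \<oplus>\<^bsub>?Q\<^esub> X = \<zero>\<^bsub>?Q\<^esub>"
      using ab by (intro bexI[of _ "fraction R (\<ominus> a) b"])
        (simp_all add: X Quot_zero[OF ab(2)] Quot_add_same_denom fraction_in_Quot l_neg)
  qed
  have monoid: "comm_monoid ?Q"
  proof (rule comm_monoidI)
    show "\<one>\<^bsub>?Q\<^esub> \<in> carrier ?Q"
      by (simp add: Quot_one fraction_in_Quot one_in_denoms)
  next
    fix X Y assume "X \<in> carrier ?Q" "Y \<in> carrier ?Q"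
    then obtain a b c d where cl: "a \<in> carrier R" "b \<in> denoms R" "c \<in> carrier R" "d \<in> denoms R"
      and XY: "X = fraction R a b" "Y = fraction R c d"
      by (metis Quot_field_cases)
    show "X \<otimes>\<^bsub>?Q\<^esub> Y \<in> carrier ?Q"
      using cl by (simp add: XY Quot_mult denoms_mult fraction_in_Quot)
    show "X \<otimes>\<^bsub>?Q\<^esub> Y = Y \<otimes>\<^bsub>?Q\<^esub> X"
      using cl by (simp add: XY Quot_mult m_comm denoms_closed)
  next
    fix X Y Z assume "X \<in> carrier ?Q" "Y \<in> carrier ?Q" "Z \<in> carrier ?Q"
    then obtain x y z d where xyz: "x \<in> carrier R" "y \<in> carrier R" "z \<in> carrier R" "d \<in> denoms R"
      and XYZ: "X = fraction R x (d \<otimes> d)" "Y = fraction R y (d \<otimes> d)" "Z = fraction R z (d \<otimes> d)"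
      by (rule Quot_common_denom)
    show "X \<otimes>\<^bsub>?Q\<^esub> Y \<otimes>\<^bsub>?Q\<^esub> Z = X \<otimes>\<^bsub>?Q\<^esub> (Y \<otimes>\<^bsub>?Q\<^esub> Z)"
      using xyz by (simp add: XYZ Quot_mult denoms_mult m_assoc denoms_closed)
  next
    fix X assume "X \<in> carrier ?Q"
    then obtain a b where ab: "a \<in> carrier R" "b \<in> denoms R" and X: "X = fraction R a b"
      by (rule Quot_field_cases)
    show "\<one>\<^bsub>?Q\<^esub> \<otimes>\<^bsub>?Q\<^esub> X = X"
      using ab by (simp add: X Quot_one Quot_mult one_in_denoms denoms_closed)
  qed
  have "cring ?Q"
  proof (rule cringI[OF abelian monoid])
    fix X Y Z assume "X \<in> carrier ?Q" "Y \<in> carrier ?Q" "Z \<in> carrier ?Q"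
    then obtain x y z d where xyz: "x \<in> carrier R" "y \<in> carrier R" "z \<in> carrier R" "d \<in> denoms R"
      and XYZ: "X = fraction R x (d \<otimes> d)" "Y = fraction R y (d \<otimes> d)" "Z = fraction R z (d \<otimes> d)"
      by (rule Quot_common_denom)
    show "(X \<oplus>\<^bsub>?Q\<^esub> Y) \<otimes>\<^bsub>?Q\<^esub> Z = X \<otimes>\<^bsub>?Q\<^esub> Z \<oplus>\<^bsub>?Q\<^esub> Y \<otimes>\<^bsub>?Q\<^esub> Z"
      using xyz by (simp add: XYZ Quot_mult Quot_add_same_denom denoms_mult l_distr)
  qed
  then interpret Q: cring ?Q .
  \<comment> \<open>Zero is rewritten with the denominator \<open>b\<close> itself, so equality of
    classes reads \<open>a \<otimes> b = \<zero>\<close>, and \<open>b\<close> is nonzero in a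
    domain.\<close>
  have zero_iff: "fraction R a b = \<zero>\<^bsub>?Q\<^esub> \<longleftrightarrow> a = \<zero>" if "a \<in> carrier R" "b \<in> denoms R" for a b
    using that integral_iff[of a b]
    by (auto simp: Quot_zero[OF that(2)] fraction_eq_iff denoms_closed denoms_def)
  show ?thesis
  proof (rule Q.cring_fieldI2)
    show "\<zero>\<^bsub>?Q\<^esub> \<noteq> \<one>\<^bsub>?Q\<^esub>"
      using zero_iff[of \<one> \<one>] by (simp add: Quot_one one_in_denoms)
  next
    fix X assume X: "X \<in> carrier ?Q" "X \<noteq> \<zero>\<^bsub>?Q\<^esub>"
    obtain a b where ab: "a \<in> carrier R" "b \<in> denoms R" and Xab: "X = fraction R a b"
      using X(1) by (rule Quot_field_cases)
    have a: "a \<in> denoms R" using X(2) ab Xab zero_iff by (simp add: denoms_def)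
    \<comment> \<open>The inverse of \<open>a/b\<close> is \<open>b/a\<close>, a legitimate fraction
      because \<open>a\<close> is nonzero.\<close>
    show "\<exists>Y\<in>carrier ?Q. X \<otimes>\<^bsub>?Q\<^esub> Y = \<one>\<^bsub>?Q\<^esub>"
      using ab a by (intro bexI[of _ "fraction R b a"])
        (simp_all add: Xab Quot_mult Quot_one fraction_in_Quot fraction_eq_iff denoms_mult
          one_in_denoms denoms_closed m_comm)
  qed
qed

section \<open>The order on the field of fractions\<close>

text \<open>The absence of zero divisors is derived from the order in \<open>is_domain\<close>; the
  sublocale declaration then makes the calculus of fractions available here.\<close>

locale quasi_ordered_domain = quasi_ordered_ring +
  assumes support_trivial: "qo_support R (\<preceq>) = {\<zero>}"
begin

section \<open>Positivity of nonzero squares and the domain property\<close>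

lemma equiv_zero_iff: "x \<in> carrier R \<Longrightarrow> qo_equiv (\<preceq>) x \<zero> \<longleftrightarrow> x = \<zero>"
  using support_trivial by (auto simp: qo_support_def)

text \<open>Add \<open>\<ominus> x\<close> to both sides of \<open>x \<preceq> \<zero>\<close>. The
  proviso of \<open>QR4\<close> asks that \<open>\<ominus> x\<close> be inequivalent to zero, which
  holds by triviality of the support.\<close>

lemma minus_nonneg:
  assumes "x \<in> carrier R" "x \<noteq> \<zero>" "x \<preceq> \<zero>"
  shows "\<zero> \<preceq> \<ominus> x"
  using assms QR4[of x \<zero> "\<ominus> x"] equiv_zero_iff[of "\<ominus> x"] by (simp add: r_neg)

lemma square_pos:
  assumes "x \<in> denoms R"
  shows "qo_less (\<preceq>) \<zero> (x \<otimes> x)"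
proof -
  \<comment> \<open>For nonnegative \<open>z\<close>, \<open>QR3\<close> makes the square
    nonnegative. Were it also below zero, \<open>QR2\<close> would put \<open>z\<close> below zero,
    hence in the trivial support.\<close>
  have pos: "qo_less (\<preceq>) \<zero> (z \<otimes> z)" if z: "z \<in> carrier R" "z \<noteq> \<zero>" "\<zero> \<preceq> z" for z
  proof -
    have "\<not> z \<preceq> \<zero>" using equiv_zero_iff[of z] z by (simp add: qo_equiv_def)
    then show ?thesis using QR3[of \<zero> z z] QR2[of z z] z by (auto simp: qo_less_def)
  qed
  have x: "x \<in> carrier R" "x \<noteq> \<zero>" using assms by (auto simp: denoms_def)
  show ?thesis
  proof (cases "\<zero> \<preceq> x")
    case True
    then show ?thesis using pos x by simp
  next
    case False
    \<comment> \<open>Otherwise \<open>x\<close> lies below zero by totality, and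
      \<open>\<ominus> x\<close> is nonnegative with the same square.\<close>
    then have "\<zero> \<preceq> \<ominus> x" using qo_total[of x \<zero>] x minus_nonneg by auto
    then show ?thesis using pos[of "\<ominus> x"] x by (simp add: l_minus r_minus)
  qed
qed

text \<open>Applied to \<open>a \<otimes> b\<close> itself, \<open>QR2\<close> gives no
  contradiction, as a factor may well lie below zero. It is applied to the squares, which are
  strictly positive although their product is the square of \<open>a \<otimes> b\<close>, that is,
  zero.\<close>

lemma is_domain: "domain R"
proof (unfold_locales)
  show "\<one> \<noteq> \<zero>" using QR1 by (auto simp: qo_less_def)
  fix a b assume ab: "a \<otimes> b = \<zero>" "a \<in> carrier R" "b \<in> carrier R"
  show "a = \<zero> \<or> b = \<zero>"
  proof (rule ccontr)
    assume "\<not> (a = \<zero> \<or> b = \<zero>)"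
    then have "\<not> a \<otimes> a \<preceq> \<zero>" "\<not> b \<otimes> b \<preceq> \<zero>"
      using square_pos ab by (auto simp: qo_less_def denoms_def)
    moreover have "(a \<otimes> a) \<otimes> (b \<otimes> b) = (a \<otimes> b) \<otimes> (a \<otimes> b)"
      using ab(2,3) by (simp add: m_ac)
    then have "(a \<otimes> a) \<otimes> (b \<otimes> b) \<preceq> \<zero>"
      using ab qo_refl by simp
    ultimately show False using QR2[of "a \<otimes> a" "b \<otimes> b"] ab by simp
  qed
qed

end

sublocale quasi_ordered_domain \<subseteq> domain R
  by (rule is_domain)

context quasi_ordered_domain
begin

section \<open>Comparison of fractions through numerators\<close>

lemma mult_pos_le_iff:
  assumes "x \<in> carrier R" "y \<in> carrier R" "z \<in> carrier R" "qo_less (\<preceq>) \<zero> z"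
  shows "x \<otimes> z \<preceq> y \<otimes> z \<longleftrightarrow> x \<preceq> y"
  using QR3[of x y z] QR5[of x y z] assms by (auto simp: qo_less_def)

lemma mult_square_le_iff:
  assumes "x \<in> carrier R" "y \<in> carrier R" "d \<in> denoms R"
  shows "x \<otimes> (d \<otimes> d) \<preceq> y \<otimes> (d \<otimes> d) \<longleftrightarrow> x \<preceq> y"
  using assms by (simp add: mult_pos_le_iff square_pos denoms_closed)

lemma square_eq: "x \<in> carrier R \<Longrightarrow> x [^] (2::nat) = x \<otimes> x"
  by (simp add: numeral_2_eq_2)

text \<open>The first comparison multiplied by the square of \<open>b' \<otimes> y'\<close> and the
  second multiplied by the square of \<open>b \<otimes> y\<close> are the same inequality. Both
  multipliers are nonzero squares, so they neither lose nor add information.\<close>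

lemma frac_le_rep_cong:
  assumes cl: "a \<in> carrier R" "b \<in> denoms R" "a' \<in> carrier R" "b' \<in> denoms R"
      "x \<in> carrier R" "y \<in> denoms R" "x' \<in> carrier R" "y' \<in> denoms R"
    and eqs: "a \<otimes> b' = a' \<otimes> b" "x \<otimes> y' = x' \<otimes> y"
  shows "frac_le_rep R (\<preceq>) a b x y \<longleftrightarrow> frac_le_rep R (\<preceq>) a' b' x' y'"
proof -
  note cl' = cl cl(2,4,6,8)[THEN denoms_closed]
  let ?s = "(b' \<otimes> y') \<otimes> (b' \<otimes> y')" and ?t = "(b \<otimes> y) \<otimes> (b \<otimes> y)"
  have "(a \<otimes> b \<otimes> (y \<otimes> y)) \<otimes> ?s = (a \<otimes> b') \<otimes> (b \<otimes> b' \<otimes> (y \<otimes> y) \<otimes> (y' \<otimes> y'))"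
    using cl' by (simp add: m_ac)
  also have "\<dots> = (a' \<otimes> b' \<otimes> (y' \<otimes> y')) \<otimes> ?t"
    using cl' by (simp add: eqs(1) m_ac)
  finally have l: "(a \<otimes> b \<otimes> (y \<otimes> y)) \<otimes> ?s = (a' \<otimes> b' \<otimes> (y' \<otimes> y')) \<otimes> ?t" .
  have "(x \<otimes> y \<otimes> (b \<otimes> b)) \<otimes> ?s = (x \<otimes> y') \<otimes> (y \<otimes> y' \<otimes> (b \<otimes> b) \<otimes> (b' \<otimes> b'))"
    using cl' by (simp add: m_ac)
  also have "\<dots> = (x' \<otimes> y' \<otimes> (b' \<otimes> b')) \<otimes> ?t"
    using cl' by (simp add: eqs(2) m_ac)
  finally have r: "(x \<otimes> y \<otimes> (b \<otimes> b)) \<otimes> ?s = (x' \<otimes> y' \<otimes> (b' \<otimes> b')) \<otimes> ?t" .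
  have "frac_le_rep R (\<preceq>) a b x y
      \<longleftrightarrow> (a \<otimes> b \<otimes> (y \<otimes> y)) \<otimes> ?s \<preceq> (x \<otimes> y \<otimes> (b \<otimes> b)) \<otimes> ?s"
    using cl' denoms_mult[OF cl(4,8)] by (simp add: frac_le_rep_def square_eq mult_square_le_iff)
  also have "\<dots> \<longleftrightarrow> frac_le_rep R (\<preceq>) a' b' x' y'"
    unfolding l r
    using cl' denoms_mult[OF cl(2,6)] by (simp add: frac_le_rep_def square_eq mult_square_le_iff)
  finally show ?thesis .
qed

text \<open>The existential in \<open>frac_le\<close> is harmless: any witnessing representatives
  can be exchanged for the given ones by \<open>frac_le_rep_cong\<close>, and the given ones are
  themselves witnesses.\<close>

lemma frac_le_iff_rep:
  assumes "a \<in> carrier R" "b \<in> denoms R" "x \<in> carrier R" "y \<in> denoms R"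
  shows "frac_le R (\<preceq>) (fraction R a b) (fraction R x y) \<longleftrightarrow> frac_le_rep R (\<preceq>) a b x y"
proof
  assume "frac_le R (\<preceq>) (fraction R a b) (fraction R x y)"
  then obtain a' b' x' y' where "(a', b') \<in> fraction R a b" "(x', y') \<in> fraction R x y"
    and "frac_le_rep R (\<preceq>) a' b' x' y'"
    by (auto simp: frac_le_def)
  then show "frac_le_rep R (\<preceq>) a b x y"
    using frac_le_rep_cong[of a b a' b' x y x' y'] assms fraction_memD by blast
next
  assume "frac_le_rep R (\<preceq>) a b x y"
  then show "frac_le R (\<preceq>) (fraction R a b) (fraction R x y)"
    using fraction_self_mem assms by (fastforce simp: frac_le_def)
qed

text \<open>With both denominators equal to \<open>d \<otimes> d\<close>, each side of the defining
  inequality is the numerator times the sixth power of \<open>d\<close>. This is the square of the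
  cube \<open>?e\<close>, so it cancels.\<close>

lemma frac_le_square_denom:
  assumes "a \<in> carrier R" "x \<in> carrier R" "d \<in> denoms R"
  shows "frac_le R (\<preceq>) (fraction R a (d \<otimes> d)) (fraction R x (d \<otimes> d)) \<longleftrightarrow> a \<preceq> x"
proof -
  let ?e = "d \<otimes> d \<otimes> d"
  have e: "?e \<in> denoms R" using assms(3) by (simp add: denoms_mult)
  have "z \<otimes> (d \<otimes> d) \<otimes> (d \<otimes> d) [^] (2::nat) = z \<otimes> (?e \<otimes> ?e)" if "z \<in> carrier R" for z
    using that denoms_closed[OF assms(3)] by (simp add: square_eq m_ac)
  then show ?thesis
    using assms e by (simp add: frac_le_iff_rep frac_le_rep_def denoms_mult mult_square_le_iff)
qed

lemma quasi_ordered_field_Quot: "quasi_ordered_field (Quot_field R) (frac_le R (\<preceq>))"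
proof -
  let ?Q = "Quot_field R" and ?le = "frac_le R (\<preceq>)"
  interpret Q: field ?Q by (rule field_Quot_field)
  show ?thesis
  proof
    fix X Y Z assume "X \<in> carrier ?Q" "Y \<in> carrier ?Q" "Z \<in> carrier ?Q"
    then obtain x y z d where xyz: "x \<in> carrier R" "y \<in> carrier R" "z \<in> carrier R" "d \<in> denoms R"
      and XYZ: "X = fraction R x (d \<otimes> d)" "Y = fraction R y (d \<otimes> d)" "Z = fraction R z (d \<otimes> d)"
      by (rule Quot_common_denom)
    \<comment> \<open>Zero is given the same denominator as the other elements, so that comparisons
      with it are also comparisons of numerators.\<close>
    note zero = Quot_zero[OF denoms_mult[OF xyz(4) xyz(4)]]
    show "?le X Z" if "?le X Y" "?le Y Z"
      using that xyz qo_trans[of x y z] by (simp add: XYZ frac_le_square_denom)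
    \<comment> \<open>The products have denominator
      \<open>(d \<otimes> d) \<otimes> (d \<otimes> d)\<close>, again of square form, now with
      \<open>d \<otimes> d\<close> in the role of \<open>d\<close>.\<close>
    show "?le (X \<otimes>\<^bsub>?Q\<^esub> Z) (Y \<otimes>\<^bsub>?Q\<^esub> Z)" if "?le X Y" "?le \<zero>\<^bsub>?Q\<^esub> Z"
      using that xyz QR3[of x y z]
      by (simp add: XYZ zero Quot_mult frac_le_square_denom denoms_mult)
    show "?le (X \<oplus>\<^bsub>?Q\<^esub> Z) (Y \<oplus>\<^bsub>?Q\<^esub> Z)" if "?le X Y" "\<not> qo_equiv ?le Z Y"
      using that xyz QR4[of x y z]
      by (simp add: XYZ Quot_add_same_denom frac_le_square_denom denoms_mult qo_equiv_def)
  next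
    fix X Y assume "X \<in> carrier ?Q" "Y \<in> carrier ?Q"
    then obtain x y d where xy: "x \<in> carrier R" "y \<in> carrier R" "d \<in> denoms R"
      and XY: "X = fraction R x (d \<otimes> d)" "Y = fraction R y (d \<otimes> d)"
      using Quot_common_denom[of X Y Y] by metis
    note zero = Quot_zero[OF denoms_mult[OF xy(3) xy(3)]]
    show "?le X Y \<or> ?le Y X"
      using xy qo_total[of x y] by (simp add: XY frac_le_square_denom)
    show "?le X X"
      using xy qo_refl by (simp add: XY frac_le_square_denom)
    show "X = \<zero>\<^bsub>?Q\<^esub>" if "qo_equiv ?le X \<zero>\<^bsub>?Q\<^esub>"
      using that xy equiv_zero_iff[of x] by (simp add: XY zero frac_le_square_denom qo_equiv_def)
  qed
qed

end

theorem proposition4p3: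
  fixes R :: "('a, 'm) ring_scheme" and leq :: "'a \<Rightarrow> 'a \<Rightarrow> bool"
  assumes "quasi_ordered_ring R leq"
    and "qo_support R leq = {\<zero>\<^bsub>R\<^esub>}"
  shows "domain R \<and>
         (\<forall>a\<in>carrier R. \<forall>b\<in>carrier R - {\<zero>\<^bsub>R\<^esub>}. \<forall>a'\<in>carrier R. \<forall>b'\<in>carrier R - {\<zero>\<^bsub>R\<^esub>}.
         \<forall>x\<in>carrier R. \<forall>y\<in>carrier R - {\<zero>\<^bsub>R\<^esub>}. \<forall>x'\<in>carrier R. \<forall>y'\<in>carrier R - {\<zero>\<^bsub>R\<^esub>}.
           fraction R a b = fraction R a' b' \<longrightarrow> fraction R x y = fraction R x' y' \<longrightarrow>
           (frac_le_rep R leq a b x y \<longleftrightarrow> frac_le_rep R leq a' b' x' y')) \<and>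
         (\<forall>a\<in>carrier R. \<forall>b\<in>carrier R - {\<zero>\<^bsub>R\<^esub>}. \<forall>x\<in>carrier R. \<forall>y\<in>carrier R - {\<zero>\<^bsub>R\<^esub>}.
           frac_le R leq (fraction R a b) (fraction R x y) \<longleftrightarrow>
           leq (a \<otimes>\<^bsub>R\<^esub> b \<otimes>\<^bsub>R\<^esub> y [^]\<^bsub>R\<^esub> (2::nat)) (x \<otimes>\<^bsub>R\<^esub> y \<otimes>\<^bsub>R\<^esub> b [^]\<^bsub>R\<^esub> (2::nat))) \<and>
         (\<forall>x\<in>carrier R. \<forall>y\<in>carrier R.
           frac_le R leq (fraction R x \<one>\<^bsub>R\<^esub>) (fraction R y \<one>\<^bsub>R\<^esub>) \<longleftrightarrow> leq x y) \<and>
         quasi_ordered_field (Quot_field R) (frac_le R leq)"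
proof -
  interpret quasi_ordered_domain R leq
    using assms by (simp add: quasi_ordered_domain_def quasi_ordered_domain_axioms_def)
  show ?thesis
  proof (intro conjI ballI impI)
    show "domain R" by (rule is_domain)
    show "quasi_ordered_field (Quot_field R) (frac_le R leq)" by (rule quasi_ordered_field_Quot)
  next
    fix a b a' b' x y x' y'
    assume "a \<in> carrier R" "b \<in> carrier R - {\<zero>\<^bsub>R\<^esub>}" "a' \<in> carrier R" "b' \<in> carrier R - {\<zero>\<^bsub>R\<^esub>}"
      "x \<in> carrier R" "y \<in> carrier R - {\<zero>\<^bsub>R\<^esub>}" "x' \<in> carrier R" "y' \<in> carrier R - {\<zero>\<^bsub>R\<^esub>}"
      "fraction R a b = fraction R a' b'" "fraction R x y = fraction R x' y'"
    then show "frac_le_rep R leq a b x y \<longleftrightarrow> frac_le_rep R leq a' b' x' y'"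
      unfolding denoms_def[symmetric] by (intro frac_le_rep_cong) (simp_all add: fraction_eq_iff)
  next
    fix a b x y
    assume "a \<in> carrier R" "b \<in> carrier R - {\<zero>\<^bsub>R\<^esub>}" "x \<in> carrier R" "y \<in> carrier R - {\<zero>\<^bsub>R\<^esub>}"
    then show "frac_le R leq (fraction R a b) (fraction R x y) \<longleftrightarrow>
        leq (a \<otimes>\<^bsub>R\<^esub> b \<otimes>\<^bsub>R\<^esub> y [^]\<^bsub>R\<^esub> (2::nat)) (x \<otimes>\<^bsub>R\<^esub> y \<otimes>\<^bsub>R\<^esub> b [^]\<^bsub>R\<^esub> (2::nat))"
      unfolding denoms_def[symmetric] by (simp add: frac_le_iff_rep frac_le_rep_def)
  next
    fix x y assume "x \<in> carrier R" "y \<in> carrier R"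
    then show "frac_le R leq (fraction R x \<one>\<^bsub>R\<^esub>) (fraction R y \<one>\<^bsub>R\<^esub>) \<longleftrightarrow> leq x y"
      \<comment> \<open>The denominator one is the square of one, so the extension property is the
        comparison of numerators with \<open>d\<close> equal to one.\<close>
      using frac_le_square_denom[of x y "\<one>\<^bsub>R\<^esub>"] by (simp add: one_in_denoms)
  qed
qed

end
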